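(* For every positive integer $n$, the set $\mathscr{C}_{F_{2k-1}}(n)$ of compositions of $n$ in which each part equal to $k$ comes in $F_{2k-1}$ colors is in one-to-one correspondence with the set of order-consecutive partition sequences of $[n]=\{1,\dots,n\}$.
   Context: $F_0=0$, $F_1=1$, $F_n=F_{n-1}+F_{n-2}$ are the Fibonacci numbers. A $w$-colored composition of $n$ (for a sequence $(w_k)$ of nonnegative integers) is a composition $(j_1,\dots,j_m)$ of $n$ together with a choice of one of $w_{j_i}$ colors for each part $j_i$; $\mathscr{C}_{w_k}(n)$ is the set of these. An ordered partition sequence of $[n]$ is a sequence $(S_1,\dots,S_p)$ ($p\ge1$) of pairwise disjoint nonempty sets whose union is $[n]$; it is order-consecutive if for every $k=1,\dots,p$ the union $S_1\cup\dots\cup S_k$ is a set of consecutive integers. *)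

theory Defs
  imports "HOL-Number_Theory.Fib"
begin

definition compositions :: "nat \<Rightarrow> nat list set" where
  "compositions n = {js. (\<forall>j\<in>set js. 1 \<le> j) \<and> sum_list js = n}"

text \<open>A coloured composition is a list of pairs (part, colour), where the colours available
  for a part \<open>j\<close> are the numbers \<open>1, \<dots>, w j\<close>.\<close>

definition colored_compositions :: "(nat \<Rightarrow> nat) \<Rightarrow> nat \<Rightarrow> (nat \<times> nat) list set" where
  "colored_compositions w n =
     {xs. map fst xs \<in> compositions n \<and> (\<forall>(j, c)\<in>set xs. c \<in> {1..w j})}"

definition ordered_partition_sequences :: "'a set \<Rightarrow> 'a set list set" where
  "ordered_partition_sequences A =
     {Ss. Ss \<noteq> [] \<and> (\<forall>S\<in>set Ss. S \<noteq> {})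
        \<and> (\<forall>i<length Ss. \<forall>j<length Ss. i \<noteq> j \<longrightarrow> Ss ! i \<inter> Ss ! j = {})
        \<and> \<Union>(set Ss) = A}"

definition consecutive :: "nat set \<Rightarrow> bool" where
  "consecutive S \<longleftrightarrow> (\<exists>a b. S = {a..b})"

definition order_consecutive :: "nat set list \<Rightarrow> bool" where
  "order_consecutive Ss \<longleftrightarrow> (\<forall>k\<in>{1..length Ss}. consecutive (\<Union>(set (take k Ss))))"

end

theory Submission
  imports Defs
begin

text \<open>Both families are finite and are counted by the same sequence. Removing the first part of a
  coloured composition gives \<open>c(n) = \<Sum>k. F(2k-1) c(n-k)\<close>; removing the last set of an
  order-consecutive partition sequence leaves such a sequence of one of the \<open>n-m+1\<close> subintervals of
  size \<open>m < n\<close>, so \<open>a(n) = 1 + \<Sum>m<n. (n-m+1) a(m)\<close>. The first recurrence implies the second,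
  via \<open>\<Sum>k. F(2k) c(n-k) = c(1) + \<dots> + c(n-1) + c(n)\<close>.\<close>

section \<open>Counting coloured compositions by their first part\<close>

lemma colored_compositions_0: "colored_compositions w 0 = {[]}"
proof -
  have "xs = []" if "\<forall>j\<in>set (map fst xs). 1 \<le> j" "sum_list (map fst xs) = 0"
    for xs :: "(nat \<times> nat) list"
    using that by (cases xs) auto
  then show ?thesis
    unfolding colored_compositions_def compositions_def by auto
qed

text \<open>Parts are positive, so the first one can be written \<open>Suc i\<close>, which leaves
  \<open>n - i\<close> for the rest. The nested \<open>SIGMA\<close> chooses part, colour and
  remainder in turn, so its cardinality is an iterated sum.\<close>

lemma colored_compositions_Suc:
  "colored_compositions w (Suc n) =
     (\<lambda>((i, c), xs). (Suc i, c) # xs) `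
       (SIGMA p : (SIGMA i : {..n}. {1..w (Suc i)}). colored_compositions w (n - fst p))"
  (is "?L = ?f ` ?R")
proof
  show "?f ` ?R \<subseteq> ?L"
    unfolding colored_compositions_def compositions_def by auto
  show "?L \<subseteq> ?f ` ?R"
  proof
    fix ys assume ys: "ys \<in> ?L"
    then obtain k c xs where eq: "ys = (k, c) # xs"
      unfolding colored_compositions_def compositions_def
      by (cases ys) auto
    from ys eq obtain i where k: "k = Suc i"
      unfolding colored_compositions_def compositions_def by (cases k) auto
    have "((i, c), xs) \<in> ?R"
      using ys unfolding eq k colored_compositions_def compositions_def by auto
    then show "ys \<in> ?f ` ?R"
      using eq k by force
  qed
qed

lemma finite_colored_compositions: "finite (colored_compositions w n)"
proof (induction n rule: less_induct)
  case (less n)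
  show ?case
  proof (cases n)
    case (Suc m)
    then show ?thesis
      unfolding Suc colored_compositions_Suc
      by (intro finite_imageI finite_SigmaI less.IH) (auto simp: Suc)
  qed (simp add: colored_compositions_0)
qed

lemma card_colored_compositions_Suc:
  "card (colored_compositions w (Suc n)) =
     (\<Sum>i\<le>n. w (Suc i) * card (colored_compositions w (n - i)))"
proof -
  have inj: "inj_on (\<lambda>((i, c), xs). (Suc i, c) # xs) X" for X :: "((nat \<times> nat) \<times> _) set"
    by (auto simp: inj_on_def)
  have "card (colored_compositions w (Suc n)) =
      (\<Sum>p\<in>(SIGMA i : {..n}. {1..w (Suc i)}). card (colored_compositions w (n - fst p)))"
    unfolding colored_compositions_Suc card_image[OF inj]
    by (rule card_SigmaI) (auto simp: finite_colored_compositions)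
  also have "\<dots> = (\<Sum>i\<le>n. \<Sum>c\<in>{1..w (Suc i)}. card (colored_compositions w (n - i)))"
    by (subst sum.Sigma) (auto intro!: sum.cong)
  finally show ?thesis by simp
qed

section \<open>Counting order-consecutive partition sequences by their last set\<close>

text \<open>The ground set is a parameter because removing the last set leaves a sequence on a
  subinterval that need not start at 1.\<close>

definition order_consecutive_partitions :: "nat set \<Rightarrow> nat set list set" where
  "order_consecutive_partitions A =
     {Ss \<in> ordered_partition_sequences A. order_consecutive Ss}"

lemma Union_order_consecutive_partitions:
  "Ss \<in> order_consecutive_partitions A \<Longrightarrow> \<Union>(set Ss) = A"
  by (simp add: order_consecutive_partitions_def ordered_partition_sequences_def)

text \<open>The last set is forced: it is the complement of the union of the others, and its being
  nonempty is the properness of that union in \<open>A\<close>. Hence removing it loses no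
  information once \<open>A\<close> is known.\<close>

lemma ordered_partition_sequences_snoc:
  assumes "Ss \<noteq> []"
  shows "Ss @ [T] \<in> ordered_partition_sequences A \<longleftrightarrow>
    Ss \<in> ordered_partition_sequences (\<Union>(set Ss)) \<and> \<Union>(set Ss) \<subset> A \<and> T = A - \<Union>(set Ss)"
    (is "?L \<longleftrightarrow> ?R")
proof
  assume L: ?L
  have dis: "(Ss @ [T]) ! i \<inter> (Ss @ [T]) ! j = {}"
    if "i < Suc (length Ss)" "j < Suc (length Ss)" "i \<noteq> j" for i j
    using L that unfolding ordered_partition_sequences_def by simp
  have 1: "Ss ! i \<inter> Ss ! j = {}" if "i < length Ss" "j < length Ss" "i \<noteq> j" for i j
    using dis[of i j] that by (simp add: nth_append)
  have "S \<inter> T = {}" if S: "S \<in> set Ss" for S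
  proof -
    obtain k where "k < length Ss" "S = Ss ! k"
      using S by (metis in_set_conv_nth)
    then show ?thesis
      using dis[of k "length Ss"] by (simp add: nth_append)
  qed
  then have 2: "\<Union>(set Ss) \<inter> T = {}"
    by blast
  have 3: "T \<noteq> {}" "\<forall>S\<in>set Ss. S \<noteq> {}" "A = \<Union>(set Ss) \<union> T"
    using L unfolding ordered_partition_sequences_def by auto
  have "Ss \<in> ordered_partition_sequences (\<Union>(set Ss))"
    using assms 1 3(2) unfolding ordered_partition_sequences_def by blast
  with 2 3(1,3) show ?R
    by blast
next
  assume R: ?R
  have "(Ss @ [T]) ! i \<inter> (Ss @ [T]) ! j = {}"
    if "i < Suc (length Ss)" "j < Suc (length Ss)" "i \<noteq> j" for i j
  proof -
    have "Ss ! k \<inter> T = {}" if "k < length Ss" for k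
      using R nth_mem[OF that] by auto
    then show ?thesis
      using R that unfolding ordered_partition_sequences_def
      by (auto simp: nth_append less_Suc_eq)
  qed
  then show ?L
    using R unfolding ordered_partition_sequences_def by auto
qed

lemma order_consecutive_snoc:
  "order_consecutive (Ss @ [T]) \<longleftrightarrow>
     order_consecutive Ss \<and> consecutive (\<Union>(set (Ss @ [T])))"
proof -
  have "{1..length (Ss @ [T])} = insert (Suc (length Ss)) {1..length Ss}"
    by auto
  then show ?thesis
    unfolding order_consecutive_def by (auto simp: Un_commute)
qed

lemma order_consecutive_imp_consecutive_Union:
  assumes "order_consecutive Ss" "Ss \<noteq> []"
  shows "consecutive (\<Union>(set Ss))"
  using assms unfolding order_consecutive_def
  by (metis One_nat_def Suc_leI atLeastAtMost_iff length_greater_0_conv order_refl take_all)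

text \<open>Parametrizes the possible unions of all sets but the last. An interval of size
  \<open>Suc i\<close> starting at \<open>p\<close> fits iff \<open>a \<le> p\<close> and
  \<open>p + i \<le> a + n\<close>, so each size has \<open>Suc (n - i)\<close> positions.\<close>

lemma consecutive_psubset_atLeastLessThan:
  assumes "consecutive S" "S \<noteq> {}" "S \<subset> {a..<a + Suc n}"
  obtains i p where "i < n" "p \<in> {a..a + (n - i)}" "S = {p..<p + Suc i}"
proof -
  obtain p q where S: "S = {p..q}"
    using assms(1) unfolding consecutive_def by blast
  with assms(2) have pq: "p \<le> q" by simp
  with S assms(3) have sub: "a \<le> p" "q < a + Suc n"
    by (auto simp: subset_eq psubset_eq)
  have "card S < card {a..<a + Suc n}"
    using assms(3) by (intro psubset_card_mono) auto
  then have "q - p < n"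
    using pq by (simp add: S)
  moreover have "S = {p..<p + Suc (q - p)}"
    using pq by (auto simp: S)
  ultimately show thesis
    using sub pq by (intro that[of "q - p" p]) auto
qed

text \<open>Either there is a single set, or the sets before the last fill a proper subinterval. The
  appended complement may fall into two pieces on both sides of that subinterval, since only the
  unions of initial sets must be consecutive.\<close>

lemma order_consecutive_partitions_Suc:
  "order_consecutive_partitions {a..<a + Suc n} =
     insert [{a..<a + Suc n}]
       ((\<lambda>((i, p), Ss). Ss @ [{a..<a + Suc n} - {p..<p + Suc i}]) `
         (SIGMA (i, p) : (SIGMA i : {..<n}. {a..a + (n - i)}).
            order_consecutive_partitions {p..<p + Suc i}))"
  (is "order_consecutive_partitions ?A = insert _ (?f ` ?R)")
proof
  have A: "consecutive ?A"
    unfolding consecutive_def by (metis add_Suc_right atLeastLessThanSuc_atLeastAtMost)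
  show "insert [?A] (?f ` ?R) \<subseteq> order_consecutive_partitions ?A"
  proof (rule insert_subsetI)
    show "[?A] \<in> order_consecutive_partitions ?A"
      using A unfolding order_consecutive_partitions_def ordered_partition_sequences_def
        order_consecutive_def by auto
    show "?f ` ?R \<subseteq> order_consecutive_partitions ?A"
    proof
      fix Ts assume "Ts \<in> ?f ` ?R"
      then obtain i p Ss where ip: "i < n" "p \<in> {a..a + (n - i)}"
        and Ss: "Ss \<in> order_consecutive_partitions {p..<p + Suc i}"
        and Ts: "Ts = Ss @ [?A - {p..<p + Suc i}]"
        by auto
      have U: "\<Union>(set Ss) = {p..<p + Suc i}"
        using Ss by (rule Union_order_consecutive_partitions)
      \<comment> \<open>The sizes \<open>Suc i\<close> and \<open>Suc n\<close> differ, so the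
        inclusion is proper and the appended set is nonempty.\<close>
      have "card {p..<p + Suc i} \<noteq> card ?A"
        using ip by simp
      then have "{p..<p + Suc i} \<noteq> ?A"
        by metis
      moreover have "{p..<p + Suc i} \<subseteq> ?A"
        using ip by auto
      ultimately have sub: "{p..<p + Suc i} \<subset> ?A"
        by blast
      then have "{p..<p + Suc i} \<union> (?A - {p..<p + Suc i}) = ?A"
        by blast
      moreover have "Ss \<noteq> []"
        using U by auto
      ultimately show "Ts \<in> order_consecutive_partitions ?A"
        using Ss sub A U
        by (simp add: Ts order_consecutive_partitions_def ordered_partition_sequences_snoc
            order_consecutive_snoc Un_commute del: Un_Diff_cancel Un_Diff_cancel2)
    qed
  qed
  show "order_consecutive_partitions ?A \<subseteq> insert [?A] (?f ` ?R)"
  proof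
    fix Ts assume Ts: "Ts \<in> order_consecutive_partitions ?A"
    then obtain Ss T where eq: "Ts = Ss @ [T]"
      unfolding order_consecutive_partitions_def ordered_partition_sequences_def
      by (cases Ts rule: rev_cases) auto
    show "Ts \<in> insert [?A] (?f ` ?R)"
    proof (cases "Ss = []")
      case True
      then show ?thesis
        using Union_order_consecutive_partitions[OF Ts] eq by simp
    next
      case False
      then have Ss: "Ss \<in> order_consecutive_partitions (\<Union>(set Ss))"
        and sub: "\<Union>(set Ss) \<subset> ?A" and T: "T = ?A - \<Union>(set Ss)" and "consecutive (\<Union>(set Ss))"
        using Ts order_consecutive_imp_consecutive_Union[of Ss]
        by (simp_all add: eq order_consecutive_partitions_def ordered_partition_sequences_snoc
            order_consecutive_snoc)
      moreover have "\<Union>(set Ss) \<noteq> {}"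
        using Ss False
        by (cases Ss) (auto simp: order_consecutive_partitions_def ordered_partition_sequences_def)
      ultimately obtain i p where ip: "i < n" "p \<in> {a..a + (n - i)}"
          "\<Union>(set Ss) = {p..<p + Suc i}"
        using consecutive_psubset_atLeastLessThan by metis
      have "((i, p), Ss) \<in> ?R"
        using ip Ss by simp
      moreover have "Ts = ?f ((i, p), Ss)"
        using eq T ip(3) by simp
      ultimately show ?thesis by blast
    qed
  qed
qed

text \<open>An induction step: \<open>g i\<close> is the count for every interval of size
  \<open>Suc i\<close>, wherever it starts, so the choice of \<open>p\<close> contributes only the
  factor \<open>Suc (n - i)\<close>.\<close>

lemma card_order_consecutive_partitions_Suc:
  assumes fin: "\<And>i p. i < n \<Longrightarrow> finite (order_consecutive_partitions {p..<p + Suc i})"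
    and card: "\<And>i p. i < n \<Longrightarrow> card (order_consecutive_partitions {p..<p + Suc i}) = g i"
  shows "finite (order_consecutive_partitions {a..<a + Suc n})"
    and "card (order_consecutive_partitions {a..<a + Suc n}) = 1 + (\<Sum>i<n. Suc (n - i) * g i)"
proof -
  let ?A = "{a..<a + Suc n}"
  let ?f = "\<lambda>((i, p), Ss). Ss @ [?A - {p..<p + Suc i}]"
  let ?I = "SIGMA i : {..<n}. {a..a + (n - i)}"
  let ?R = "SIGMA (i, p) : ?I. order_consecutive_partitions {p..<p + Suc i}"
  have finR: "finite ?R"
    using fin by (intro finite_SigmaI) auto
  then show "finite (order_consecutive_partitions ?A)"
    by (subst order_consecutive_partitions_Suc) (intro finite.insertI finite_imageI)
  \<comment> \<open>Dropping the last entry recovers \<open>Ss\<close>, and the union of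
    \<open>Ss\<close> is the interval that determines \<open>p\<close> and \<open>i\<close>.\<close>
  have inj: "inj_on ?f ?R"
  proof (rule inj_onI)
    fix x y assume xy: "x \<in> ?R" "y \<in> ?R" "?f x = ?f y"
    obtain i p Ss where x: "x = ((i, p), Ss)" by (metis surj_pair)
    obtain j q Ts where y: "y = ((j, q), Ts)" by (metis surj_pair)
    have eq: "Ss = Ts" using xy by (simp add: x y)
    have "Ss \<in> order_consecutive_partitions {p..<p + Suc i}"
      "Ss \<in> order_consecutive_partitions {q..<q + Suc j}"
      using xy by (simp_all add: x y)
    then have "{p..<p + Suc i} = {q..<q + Suc j}"
      using Union_order_consecutive_partitions by metis
    then have "p = q \<and> p + Suc i = q + Suc j"
      by (subst (asm) atLeastLessThan_eq_iff) auto
    then show "x = y" using x y eq by simp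
  qed
  \<comment> \<open>Every list in the image has a nonempty \<open>Ss\<close> before its last
    entry.\<close>
  have "[?A] \<notin> ?f ` ?R"
    by (auto simp: order_consecutive_partitions_def ordered_partition_sequences_def)
  then have "card (insert [?A] (?f ` ?R)) = Suc (card (?f ` ?R))"
    by (rule card_insert_disjoint[OF finite_imageI[OF finR]])
  also have "card (?f ` ?R) = card ?R"
    by (rule card_image[OF inj])
  finally have "card (insert [?A] (?f ` ?R)) = 1 + card ?R"
    by (simp only: plus_1_eq_Suc)
  then have "card (order_consecutive_partitions ?A) = 1 + card ?R"
    by (subst order_consecutive_partitions_Suc)
  also have "card ?R = (\<Sum>(i, p)\<in>?I. g i)"
    using fin card by (subst card_SigmaI) (auto intro!: sum.cong)
  also have "\<dots> = (\<Sum>i<n. Suc (n - i) * g i)"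
    by (subst sum.Sigma[symmetric]) (auto intro!: sum.cong simp: Suc_diff_le)
  finally show "card (order_consecutive_partitions ?A) = 1 + (\<Sum>i<n. Suc (n - i) * g i)" .
qed

section \<open>From the Fibonacci recurrence to the interval recurrence\<close>

text \<open>The two claims are proved together: the step for the first produces the convolution with
  even-indexed Fibonacci numbers, which the second evaluates.\<close>

lemma odd_fib_convolution:
  fixes c :: "nat \<Rightarrow> nat"
  assumes "c 0 = 1"
    and "\<And>n. c (Suc n) = (\<Sum>i\<le>n. fib (2 * i + 1) * c (n - i))"
  shows "c (Suc n) = 1 + (\<Sum>i<n. Suc (n - i) * c (Suc i))"
    and "(\<Sum>i\<le>n. fib (2 * i + 2) * c (n - i)) = (\<Sum>i<n. c (Suc i)) + c (Suc n)"
proof (induction n)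
  case 0
  {
    case 1
    show ?case by (simp add: assms)
  next
    case 2
    show ?case by (simp add: assms)
  }
next
  case (Suc n)
  let ?B = "\<Sum>i\<le>n. fib (2 * i + 2) * c (n - i)"
  \<comment> \<open>Split off the term \<open>i = 0\<close> and use F(2i+3) = F(2i+1) +
    F(2i+2).\<close>
  have odd: "c (Suc (Suc n)) = 2 * c (Suc n) + ?B"
  proof -
    have "c (Suc (Suc n)) = c (Suc n) + (\<Sum>i\<le>n. fib (2 * i + 3) * c (n - i))"
      by (subst assms(2), subst sum.atMost_Suc_shift) (simp add: numeral_3_eq_3)
    also have "(\<Sum>i\<le>n. fib (2 * i + 3) * c (n - i)) = c (Suc n) + ?B"
      by (subst assms(2)[of n])
        (simp add: sum.distrib[symmetric] algebra_simps numeral_3_eq_3)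
    finally show ?thesis by simp
  qed
  \<comment> \<open>Likewise with F(2i+4) = F(2i+1) + 2 F(2i+2); this gives
    \<open>2 * c (Suc n) + 2 * ?B\<close>, and \<open>odd\<close> absorbs one
    \<open>?B\<close>.\<close>
  have even: "(\<Sum>i\<le>Suc n. fib (2 * i + 2) * c (Suc n - i)) = c (Suc (Suc n)) + ?B"
  proof -
    have "(\<Sum>i\<le>Suc n. fib (2 * i + 2) * c (Suc n - i)) =
        c (Suc n) + (\<Sum>i\<le>n. (fib (2 * i + 1) + 2 * fib (2 * i + 2)) * c (n - i))"
      by (subst sum.atMost_Suc_shift) (simp add: algebra_simps, intro sum.cong, simp_all)
    also have "(\<Sum>i\<le>n. (fib (2 * i + 1) + 2 * fib (2 * i + 2)) * c (n - i)) = c (Suc n) + 2 * ?B"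
      by (subst assms(2)[of n])
        (simp only: Suc_eq_plus1 sum.distrib sum_distrib_left distrib_right mult.assoc)
    finally show ?thesis using odd by simp
  qed
  {
    case 1
    \<comment> \<open>Passing from \<open>n\<close> to \<open>Suc n\<close> raises each old weight
      by one; the new term \<open>i = n\<close> has weight 2 and matches
      \<open>2 * c (Suc n)\<close> in \<open>odd\<close>.\<close>
    have "(\<Sum>i<n. Suc (Suc n - i) * c (Suc i)) =
        (\<Sum>i<n. c (Suc i)) + (\<Sum>i<n. Suc (n - i) * c (Suc i))"
      by (simp add: sum.distrib[symmetric] Suc_diff_le)
    then show ?case
      using odd Suc by simp
  next
    case 2
    show ?case
      using even Suc(2) by simp
  }
qed

section \<open>Equal cardinalities and the bijection\<close>

text \<open>Strong induction on the length with \<open>a\<close> arbitrary, as the shorter intervals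
  start anywhere. Finiteness is carried along because both the counting step and the final bijection
  require it.\<close>

lemma finite_card_order_consecutive_partitions:
  "finite (order_consecutive_partitions {a..<a + Suc n}) \<and>
   card (order_consecutive_partitions {a..<a + Suc n}) =
     card (colored_compositions (\<lambda>k. fib (2 * k - 1)) (Suc n))"
proof (induction n arbitrary: a rule: less_induct)
  case (less n)
  let ?c = "\<lambda>n. card (colored_compositions (\<lambda>k. fib (2 * k - 1)) n)"
  have "?c (Suc m) = (\<Sum>i\<le>m. fib (2 * i + 1) * ?c (m - i))" for m
    by (subst card_colored_compositions_Suc) simp
  then have "?c (Suc n) = 1 + (\<Sum>i<n. Suc (n - i) * ?c (Suc i))"
    by (intro odd_fib_convolution) (simp add: colored_compositions_0)
  then show ?case
    using card_order_consecutive_partitions_Suc[of n "\<lambda>i. ?c (Suc i)" a] less.IH by simp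
qed

theorem theorem5p6:
  fixes n :: nat
  assumes "n \<ge> 1"
  shows "\<exists>f. bij_betw f (colored_compositions (\<lambda>k. fib (2 * k - 1)) n)
               {Ss \<in> ordered_partition_sequences {1..n}. order_consecutive Ss}"
proof -
  obtain m where n: "n = Suc m"
    using assms by (cases n) auto
  have "{1..n} = {1..<1 + Suc m}"
    by (auto simp: n)
  then show ?thesis
    using finite_card_order_consecutive_partitions[of 1 m]
    unfolding order_consecutive_partitions_def
    by (intro finite_same_card_bij finite_colored_compositions) (simp_all add: n)
qed

end
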